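(* Let $S=(X,\mathbb{A},\mathbb{R})$ be an axiomatic formal system and let $(X,\mathcal{V})$ be a valuation structure adequate for $S$. Then, for all $A\subseteq X$ and $a\in X$: (i) $A\models_{\mathcal{V}}^P a$ implies $A\vdash_S^P a$; (ii) $A\vdash_S^P a$ implies $A\models_{\mathcal{V}}^P a$.
   Context: For a positive integer $n$ and a non-empty set $X$, let $\wp^{(n)}(X)=\{A\subseteq X: |A|=n\}$. An inference rule of degree $n$ on $X$ is a relation $R\subseteq \wp^{(n)}(X)\times X$; if $(\{x_1,\dots,x_n\},x)\in R$, then $x$ is an immediate consequence of $\{x_1,\dots,x_n\}$ by $R$. For a family $\mathbb{R}$ of inference rules, $x$ is an immediate consequence of $\{x_1,\dots,x_n\}$ if it is so by some $R\in\mathbb{R}$. An axiomatic formal system is a triple $S=(X,\mathbb{A},\mathbb{R})$ where $X$ is a non-empty set (of formulas), $\mathbb{A}\subseteq X$ (the axioms), and $\mathbb{R}$ is a finite family of inference rules on $X$ (each of some positive degree). For $A\subseteq X$, an $S$-deduction from $A$ is a finite (non-empty) sequence $a_1,\dots,a_n$ of elements of $X$ such that for each $1\le i\le n$: $a_i\in A$, or $a_i\in\mathbb{A}$, or $a_i$ is an immediate consequence of a set of formulas preceding it in the sequence. Write $A\vdash_S a$ if there is an $S$-deduction $a_1,\dots,a_n$ from $A$ with $a_n=a$, and $Cn_S(A)=\{a\in X: A\vdash_S a\}$. The set $A$ is $S$-consistent if $Cn_S(A)\neq X$, and $S$-inconsistent otherwise. Standing assumption: in every axiomatic formal system, $\emptyset$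 is $S$-consistent. A paradeduction in $S$ from $A\subseteq X$ is a finite (non-empty) sequence of pairs $(A_1,a_1),\dots,(A_n,a_n)$ with $A_i\subseteq X$ and $a_i\in X$ such that: (1) $A_i$ is $S$-consistent for all $1\le i\le n$; (2) for each $1\le i\le n$ one of the following holds: (a) $a_i\in A$ and $A_i=\{a_i\}$; (b) $a_i\in\mathbb{A}$ and $A_i=\emptyset$; (c) $a_i$ is an immediate consequence of a set of preceding formulas $\{a_{i_1},\dots,a_{i_k}\}$ (with $i_1,\dots,i_k<i$) and $A_i=\bigcup_{j=1}^k A_{i_j}$. Write $A\vdash_S^P a$ if there is a paradeduction $(A_1,a_1),\dots,(A_n,a_n)$ in $S$ from $A$ with $a_n=a$. A valuation structure is a pair $(X,\mathcal{V})$ where $X$ is a non-empty set and $\mathcal{V}$ is a family of functions $v:X\to\{0,1\}$ not containing the constant function with value $1$. For $A\subseteq X$, $Mod_{\mathcal{V}}(A)=\{v\in\mathcal{V}: v(a)=1 \text{ for all } a\in A\}$, and $Mod_{\mathcal{V}}(a)=Mod_{\mathcal{V}}(\{a\})$ for $a\in X$. The set $A$ is $\mathcal{V}$-satisfiable if $Mod_{\mathcal{V}}(A)\neq\emptyset$. Write $A\models_{\mathcal{V}}a$ if $Mod_{\mathcal{V}}(A)\subseteq Mod_{\mathcal{V}}(a)$. Write $A\models_{\mathcal{V}}^P a$ if there exists a $\mathcal{V}$-satisfiable set $A'\subseteq A$ such that $A'\models_{\mathcal{V}}a$. The valuation structure $(X,\mathcal{V})$ (with the same carrier set $X$ as $S$)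 is adequate for $S$ if for all $A\subseteq X$ and $a\in X$: $A\vdash_S a$ if and only if $A\models_{\mathcal{V}}a$. *)

theory Defs
  imports "HOL-Library.FuncSet" "HOL-Library.Ramsey"
begin

text \<open>\<^term>\<open>[X]\<^bsup>n\<^esup>\<close> is the set of \<open>n\<close>-element subsets of \<open>X\<close>.\<close>

definition inference_rule :: "'a set \<Rightarrow> nat \<Rightarrow> ('a set \<times> 'a) set \<Rightarrow> bool" where
  "inference_rule X n R \<longleftrightarrow> R \<subseteq> [X]\<^bsup>n\<^esup> \<times> X"

record 'a formal_system =
  formulas :: "'a set"
  axiom_set :: "'a set"
  rule_family :: "('a set \<times> 'a) set set"

definition axiomatic_formal_system :: "'a formal_system \<Rightarrow> bool" where
  "axiomatic_formal_system S \<longleftrightarrow>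
     formulas S \<noteq> {} \<and>
     axiom_set S \<subseteq> formulas S \<and>
     finite (rule_family S) \<and>
     (\<forall>R\<in>rule_family S. \<exists>n>0. inference_rule (formulas S) n R)"

definition immediate_consequence :: "'a formal_system \<Rightarrow> 'a set \<Rightarrow> 'a \<Rightarrow> bool" where
  "immediate_consequence S P x \<longleftrightarrow> (\<exists>R\<in>rule_family S. (P, x) \<in> R)"

definition deduction :: "'a formal_system \<Rightarrow> 'a set \<Rightarrow> 'a list \<Rightarrow> bool" where
  "deduction S A as \<longleftrightarrow>
     as \<noteq> [] \<and> set as \<subseteq> formulas S \<and>
     (\<forall>i<length as.
        as ! i \<in> A \<or>
        as ! i \<in> axiom_set S \<or>
        (\<exists>P \<subseteq> set (take i as). immediate_consequence S P (as ! i)))"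

definition derivable :: "'a formal_system \<Rightarrow> 'a set \<Rightarrow> 'a \<Rightarrow> bool" where
  "derivable S A a \<longleftrightarrow> (\<exists>as. deduction S A as \<and> last as = a)"

definition Cn :: "'a formal_system \<Rightarrow> 'a set \<Rightarrow> 'a set" where
  "Cn S A = {a \<in> formulas S. derivable S A a}"

definition consistent :: "'a formal_system \<Rightarrow> 'a set \<Rightarrow> bool" where
  "consistent S A \<longleftrightarrow> Cn S A \<noteq> formulas S"

text \<open>
  In the rule clause, \<open>I\<close> is the set of the indices \<open>i\<^sub>1, \<dots>, i\<^sub>k\<close>. A formula may occur several
  times in the list with different sets attached to it, so \<open>I\<close> selects occurrences; the premises
  are the formulas at these positions.
\<close>

definition paradeduction :: "'a formal_system \<Rightarrow> 'a set \<Rightarrow> ('a set \<times> 'a) list \<Rightarrow> bool" where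
  "paradeduction S A ps \<longleftrightarrow>
     ps \<noteq> [] \<and> set ps \<subseteq> Pow (formulas S) \<times> formulas S \<and>
     (\<forall>i<length ps. consistent S (fst (ps ! i))) \<and>
     (\<forall>i<length ps.
        (snd (ps ! i) \<in> A \<and> fst (ps ! i) = {snd (ps ! i)}) \<or>
        (snd (ps ! i) \<in> axiom_set S \<and> fst (ps ! i) = {}) \<or>
        (\<exists>I \<subseteq> {..<i}.
           immediate_consequence S ((\<lambda>j. snd (ps ! j)) ` I) (snd (ps ! i)) \<and>
           fst (ps ! i) = (\<Union>j\<in>I. fst (ps ! j))))"

definition paraderivable :: "'a formal_system \<Rightarrow> 'a set \<Rightarrow> 'a \<Rightarrow> bool" where
  "paraderivable S A a \<longleftrightarrow> (\<exists>ps. paradeduction S A ps \<and> snd (last ps) = a)"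

text \<open>
  Functions \<open>X \<rightarrow> {0,1}\<close> are extensional functions, so that each is represented by exactly one
  HOL function.
\<close>

definition valuation_structure :: "'a set \<Rightarrow> ('a \<Rightarrow> nat) set \<Rightarrow> bool" where
  "valuation_structure X V \<longleftrightarrow>
     X \<noteq> {} \<and> V \<subseteq> (X \<rightarrow>\<^sub>E {0, 1}) \<and> (\<lambda>x\<in>X. 1) \<notin> V"

definition Mod :: "('a \<Rightarrow> nat) set \<Rightarrow> 'a set \<Rightarrow> ('a \<Rightarrow> nat) set" where
  "Mod V A = {v \<in> V. \<forall>a\<in>A. v a = 1}"

definition satisfiable :: "('a \<Rightarrow> nat) set \<Rightarrow> 'a set \<Rightarrow> bool" where
  "satisfiable V A \<longleftrightarrow> Mod V A \<noteq> {}"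

definition entails :: "('a \<Rightarrow> nat) set \<Rightarrow> 'a set \<Rightarrow> 'a \<Rightarrow> bool" where
  "entails V A a \<longleftrightarrow> Mod V A \<subseteq> Mod V {a}"

definition paraentails :: "('a \<Rightarrow> nat) set \<Rightarrow> 'a set \<Rightarrow> 'a \<Rightarrow> bool" where
  "paraentails V A a \<longleftrightarrow> (\<exists>A' \<subseteq> A. satisfiable V A' \<and> entails V A' a)"

definition adequate :: "('a \<Rightarrow> nat) set \<Rightarrow> 'a formal_system \<Rightarrow> bool" where
  "adequate V S \<longleftrightarrow>
     (\<forall>A \<subseteq> formulas S. \<forall>a\<in>formulas S. derivable S A a \<longleftrightarrow> entails V A a)"

end

theory Submission
  imports Defs
begin

text \<open>
  Adequacy makes consistency and satisfiability the same property of sets of formulas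
  (\<open>consistent_iff_satisfiable\<close>): no valuation is constantly \<open>1\<close>, so a model of \<open>A\<close> refutes some
  formula, which \<open>A\<close> then does not derive; and a set without models entails, hence derives, every
  formula.

  From semantics to deductions: if a satisfiable \<open>A' \<subseteq> A\<close> entails \<open>a\<close>, adequacy gives a deduction of
  \<open>a\<close> from \<open>A'\<close>. Label each formula in it with the set of those hypotheses that its derivation
  really uses. All labels are subsets of \<open>A'\<close>, hence satisfiable, hence consistent, so the labelled
  sequence is a paradeduction (\<open>deduction_labelling\<close>).

  From deductions to semantics: adequacy makes axioms and rules sound, because an axiom is derivable
  from every set, and the conclusion of a rule from the set of its premises. By induction
  along a paradeduction, each label is a subset of \<open>A\<close> that entails its formula (\<open>label_sound\<close>).
  The label of the last formula is consistent, hence satisfiable, and so witnesses paraconsistent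
  entailment.
\<close>

text \<open>
  The justification of a labelled formula \<open>p\<close>, relative to the set \<open>E\<close> of earlier labelled formulas.
  A selection of earlier positions enters a rule step only through the labelled formulas found
  there, so a subset of \<open>E\<close> can stand for it.
\<close>

definition para_justified ::
    "'a formal_system \<Rightarrow> 'a set \<Rightarrow> ('a set \<times> 'a) set \<Rightarrow> 'a set \<times> 'a \<Rightarrow> bool" where
  "para_justified S A E p \<longleftrightarrow>
     (snd p \<in> A \<and> fst p = {snd p}) \<or>
     (snd p \<in> axiom_set S \<and> fst p = {}) \<or>
     (\<exists>Q \<subseteq> E. immediate_consequence S (snd ` Q) (snd p) \<and> fst p = \<Union> (fst ` Q))"

lemma ex_indices_iff_ex_subset_take:
  assumes "i \<le> length xs"
  shows "(\<exists>I \<subseteq> {..<i}. P ((!) xs ` I)) \<longleftrightarrow> (\<exists>Q \<subseteq> set (take i xs). P Q)"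
proof -
  have "set (take i xs) = (!) xs ` {..<i}"
    using assms by (simp add: nth_image lessThan_atLeast0)
  then show ?thesis
    by (metis subset_image_iff)
qed

lemma paradeduction_iff_para_justified:
  "paradeduction S A ps \<longleftrightarrow>
     ps \<noteq> [] \<and> set ps \<subseteq> Pow (formulas S) \<times> formulas S \<and>
     (\<forall>p\<in>set ps. consistent S (fst p)) \<and>
     (\<forall>i<length ps. para_justified S A (set (take i ps)) (ps ! i))"
proof -
  have "(\<exists>I \<subseteq> {..<i}. immediate_consequence S ((\<lambda>j. snd (ps ! j)) ` I) (snd (ps ! i)) \<and>
           fst (ps ! i) = (\<Union>j\<in>I. fst (ps ! j))) \<longleftrightarrow>
        (\<exists>Q \<subseteq> set (take i ps). immediate_consequence S (snd ` Q) (snd (ps ! i)) \<and>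
           fst (ps ! i) = \<Union> (fst ` Q))" if "i < length ps" for i
    using ex_indices_iff_ex_subset_take[of i ps "\<lambda>Q. immediate_consequence S (snd ` Q) (snd (ps ! i)) \<and>
           fst (ps ! i) = \<Union> (fst ` Q)"] that
    by (simp add: image_image)
  then show ?thesis
    by (simp add: paradeduction_def para_justified_def all_set_conv_all_nth cong: conj_cong)
qed

section \<open>Adequate valuation structures\<close>

lemma consistent_iff_satisfiable:
  assumes V: "valuation_structure (formulas S) V" and ad: "adequate V S"
    and A: "A \<subseteq> formulas S"
  shows "consistent S A \<longleftrightarrow> satisfiable V A"
proof -
  have Cn: "Cn S A = {a \<in> formulas S. entails V A a}"
    using ad A by (auto simp: Cn_def adequate_def)
  show ?thesis
  proof
    assume "consistent S A"
    then show "satisfiable V A"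
      by (auto simp: consistent_def Cn satisfiable_def entails_def)
  next
    assume "satisfiable V A"
    then obtain v where v: "v \<in> Mod V A"
      by (auto simp: satisfiable_def)
    then have "v \<in> V"
      by (simp add: Mod_def)
    then have v_ext: "v \<in> extensional (formulas S)" and "v \<noteq> (\<lambda>x\<in>formulas S. 1)"
      using V by (auto simp: valuation_structure_def PiE_def)
    \<comment> \<open>Both functions are extensional, so they already differ at some formula.\<close>
    then obtain a where "a \<in> formulas S" "v a \<noteq> 1"
      using extensionalityI[OF v_ext restrict_extensional, of "\<lambda>_. 1"] by auto
    then have "\<not> entails V A a"
      using v by (auto simp: entails_def Mod_def)
    with \<open>a \<in> formulas S\<close> show "consistent S A"
      by (auto simp: consistent_def Cn)
  qed
qed

lemma satisfiable_mono: "satisfiable V A \<Longrightarrow> B \<subseteq> A \<Longrightarrow> satisfiable V B"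
  by (auto simp: satisfiable_def Mod_def)

lemma derivable_axiom:
  assumes "axiomatic_formal_system S" "a \<in> axiom_set S"
  shows "derivable S A a"
  using assms
  by (auto simp: derivable_def deduction_def axiomatic_formal_system_def intro!: exI[of _ "[a]"])

text \<open>
  Deductions being finite sequences, this rests on the finiteness of sets of premises: they can be
  listed before the conclusion.
\<close>

lemma derivable_immediate_consequence:
  assumes S: "axiomatic_formal_system S" and P: "immediate_consequence S P x"
  shows "P \<subseteq> formulas S" "x \<in> formulas S" "derivable S P x"
proof -
  obtain R where "R \<in> rule_family S" "(P, x) \<in> R"
    using P by (auto simp: immediate_consequence_def)
  moreover from this obtain n where "n > 0" "inference_rule (formulas S) n R"
    using S by (auto simp: axiomatic_formal_system_def)
  ultimately have "P \<in> [formulas S]\<^bsup>n\<^esup>" and x: "x \<in> formulas S" and "finite P"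
    by (auto simp: inference_rule_def nsets_def)
  then show PX: "P \<subseteq> formulas S" and "x \<in> formulas S"
    by (auto simp: nsets_def)
  obtain xs where xs: "set xs = P"
    using \<open>finite P\<close> finite_list by blast
  have "deduction S P (xs @ [x])"
    unfolding deduction_def
  proof (intro conjI allI impI)
    fix i assume "i < length (xs @ [x])"
    then consider "i < length xs" | "i = length xs"
      by fastforce
    then show "(xs @ [x]) ! i \<in> P \<or> (xs @ [x]) ! i \<in> axiom_set S \<or>
        (\<exists>Q \<subseteq> set (take i (xs @ [x])). immediate_consequence S Q ((xs @ [x]) ! i))"
    proof cases
      case 1
      then show ?thesis using xs by (auto simp: nth_append)
    next
      case 2
      then show ?thesis using xs P by auto
    qed
  qed (use PX x xs in auto)
  then show "derivable S P x"
    by (force simp: derivable_def)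
qed

section \<open>Labelling a deduction with the hypotheses it uses\<close>

text \<open>
  The labels are built along the sequence: a hypothesis gets its singleton, an axiom the empty set,
  and a conclusion of a rule the union of labels already attached to its premises, so that no label
  leaves \<open>A\<close>. The empty sequence is admitted so that the induction can start from it.
\<close>

lemma deduction_labelling:
  assumes "\<forall>i<length as. as ! i \<in> A \<or> as ! i \<in> axiom_set S \<or>
             (\<exists>P \<subseteq> set (take i as). immediate_consequence S P (as ! i))"
  shows "\<exists>ps. map snd ps = as \<and> (\<forall>p\<in>set ps. fst p \<subseteq> A) \<and>
           (\<forall>i<length ps. para_justified S A (set (take i ps)) (ps ! i))"
  using assms
proof (induction as rule: rev_induct)
  case Nil
  then show ?case by simp
next
  case (snoc a as)
  have "\<forall>i<length as. as ! i \<in> A \<or> as ! i \<in> axiom_set S \<or>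
             (\<exists>P \<subseteq> set (take i as). immediate_consequence S P (as ! i))"
  proof (intro allI impI)
    fix i assume "i < length as"
    then show "as ! i \<in> A \<or> as ! i \<in> axiom_set S \<or>
        (\<exists>P \<subseteq> set (take i as). immediate_consequence S P (as ! i))"
      using snoc.prems[rule_format, of i] by (simp add: nth_append)
  qed
  with snoc.IH obtain ps where ps: "map snd ps = as" "\<forall>p\<in>set ps. fst p \<subseteq> A"
      "\<forall>i<length ps. para_justified S A (set (take i ps)) (ps ! i)"
    by blast
  have "\<exists>B\<subseteq>A. para_justified S A (set ps) (B, a)"
  proof -
    consider "a \<in> A" | "a \<in> axiom_set S" | P where "P \<subseteq> set as" "immediate_consequence S P a"
      using snoc.prems[rule_format, of "length as"] by auto
    then show ?thesis
    proof cases
      case 1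
      then show ?thesis by (intro exI[of _ "{a}"]) (simp add: para_justified_def)
    next
      case 2
      then show ?thesis by (intro exI[of _ "{}"]) (simp add: para_justified_def)
    next
      case 3
      have "set as = snd ` set ps"
        using ps(1) set_map[of snd ps] by simp
      with 3(1) obtain Q where Q: "Q \<subseteq> set ps" "P = snd ` Q"
        by (auto simp: subset_image_iff)
      then have "\<Union> (fst ` Q) \<subseteq> A"
        using ps(2) by blast
      moreover have "para_justified S A (set ps) (\<Union> (fst ` Q), a)"
        using Q 3(2) by (auto simp: para_justified_def)
      ultimately show ?thesis by blast
    qed
  qed
  then obtain B where "B \<subseteq> A" "para_justified S A (set ps) (B, a)"
    by blast
  with ps show ?case
    by (intro exI[of _ "ps @ [(B, a)]"]) (auto simp: nth_append less_Suc_eq)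
qed

lemma deduction_imp_paraderivable:
  assumes ded: "deduction S A' as" and A': "A' \<subseteq> A" "A' \<subseteq> formulas S"
    and cons: "\<And>B. B \<subseteq> A' \<Longrightarrow> consistent S B"
  shows "paraderivable S A (last as)"
proof -
  have as: "as \<noteq> []" "set as \<subseteq> formulas S"
    using ded by (auto simp: deduction_def)
  obtain ps where ps: "map snd ps = as" "\<forall>p\<in>set ps. fst p \<subseteq> A'"
      "\<forall>i<length ps. para_justified S A' (set (take i ps)) (ps ! i)"
    using ded deduction_labelling[of as A' S] by (auto simp: deduction_def)
  have "ps \<noteq> []"
    using ps(1) as(1) by auto
  moreover have "set ps \<subseteq> Pow (formulas S) \<times> formulas S"
    using ps(1,2) as(2) A'(2) by fastforce
  moreover have "para_justified S A (set (take i ps)) (ps ! i)" if "i < length ps" for i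
    using ps(3) that A'(1) by (auto simp: para_justified_def)
  ultimately have "paradeduction S A ps"
    using ps(2) cons by (simp add: paradeduction_iff_para_justified)
  moreover have "snd (last ps) = last as"
    using ps(1) \<open>ps \<noteq> []\<close> by (auto simp: last_map)
  ultimately show ?thesis
    by (auto simp: paraderivable_def)
qed

section \<open>Soundness of the labels\<close>

text \<open>
  The inductive step of soundness. In a rule step, a model of the union of the labels is a model of
  each label, hence of each premise, hence of the conclusion.
\<close>

lemma para_justified_sound:
  assumes S: "axiomatic_formal_system S" and ad: "adequate V S"
    and p: "para_justified S A E p"
    and E: "\<forall>q\<in>E. fst q \<subseteq> A \<and> entails V (fst q) (snd q)"
  shows "fst p \<subseteq> A \<and> entails V (fst p) (snd p)"
proof -
  consider "snd p \<in> A" "fst p = {snd p}" | "snd p \<in> axiom_set S" "fst p = {}"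
    | Q where "Q \<subseteq> E" "immediate_consequence S (snd ` Q) (snd p)" "fst p = \<Union> (fst ` Q)"
    using p by (auto simp: para_justified_def)
  then show ?thesis
  proof cases
    case 1
    then show ?thesis by (simp add: entails_def)
  next
    case 2
    then have "snd p \<in> formulas S"
      using S by (auto simp: axiomatic_formal_system_def)
    then show ?thesis
      using 2 ad derivable_axiom[OF S, of "snd p" "{}"] by (simp add: adequate_def)
  next
    case 3
    have "entails V (snd ` Q) (snd p)"
      using derivable_immediate_consequence[OF S 3(2)] ad by (simp add: adequate_def)
    moreover have "Mod V (fst p) \<subseteq> Mod V (snd ` Q)"
    proof
      fix v assume v: "v \<in> Mod V (fst p)"
      have "v (snd q) = 1" if "q \<in> Q" for q
      proof -
        have "v \<in> Mod V (fst q)"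
          using v that 3(3) by (auto simp: Mod_def)
        moreover have "entails V (fst q) (snd q)"
          using E 3(1) that by blast
        ultimately show ?thesis
          by (auto simp: entails_def Mod_def)
      qed
      with v show "v \<in> Mod V (snd ` Q)"
        by (simp add: Mod_def)
    qed
    ultimately show ?thesis
      using 3 E by (auto simp: entails_def)
  qed
qed

lemma label_sound:
  assumes S: "axiomatic_formal_system S" and ad: "adequate V S"
    and ps: "paradeduction S A ps" and "p \<in> set ps"
  shows "fst p \<subseteq> A \<and> entails V (fst p) (snd p)"
proof -
  have "fst (ps ! i) \<subseteq> A \<and> entails V (fst (ps ! i)) (snd (ps ! i))" if "i < length ps" for i
    using that
  proof (induction i rule: less_induct)
    case (less i)
    have "para_justified S A (set (take i ps)) (ps ! i)"
      using ps less.prems by (simp add: paradeduction_iff_para_justified)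
    moreover have "\<forall>q\<in>set (take i ps). fst q \<subseteq> A \<and> entails V (fst q) (snd q)"
    proof
      fix q assume "q \<in> set (take i ps)"
      then obtain j where "j < i" "j < length ps" "q = ps ! j"
        unfolding in_set_conv_nth by auto
      then show "fst q \<subseteq> A \<and> entails V (fst q) (snd q)"
        using less.IH by simp
    qed
    ultimately show ?case
      by (rule para_justified_sound[OF S ad])
  qed
  with \<open>p \<in> set ps\<close> show ?thesis
    by (auto simp: in_set_conv_nth)
qed

theorem theorem4p3:
  fixes S :: "'a formal_system" and V :: "('a \<Rightarrow> nat) set"
  assumes "axiomatic_formal_system S"
    and "consistent S {}"
    and "valuation_structure (formulas S) V"
    and "adequate V S"
  shows "\<forall>A \<subseteq> formulas S. \<forall>a \<in> formulas S.
    (paraentails V A a \<longrightarrow> paraderivable S A a) \<and>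
    (paraderivable S A a \<longrightarrow> paraentails V A a)"
proof (intro allI ballI impI conjI)
  fix A a
  assume A: "A \<subseteq> formulas S" and a: "a \<in> formulas S" and "paraentails V A a"
  then obtain A' where A': "A' \<subseteq> A" and sat: "satisfiable V A'" and "entails V A' a"
    by (auto simp: paraentails_def)
  have A'X: "A' \<subseteq> formulas S"
    using A' A by blast
  with \<open>entails V A' a\<close> a assms(4) have "derivable S A' a"
    by (simp add: adequate_def)
  then obtain as where as: "deduction S A' as" "last as = a"
    by (auto simp: derivable_def)
  have "consistent S B" if "B \<subseteq> A'" for B
    using consistent_iff_satisfiable[OF assms(3,4), of B] satisfiable_mono[OF sat that] that A'X
    by blast
  from deduction_imp_paraderivable[OF as(1) A' A'X this] show "paraderivable S A a"
    using as(2) by simp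
next
  fix A a
  assume A: "A \<subseteq> formulas S" and "paraderivable S A a"
  then obtain ps where ps: "paradeduction S A ps" "snd (last ps) = a"
    by (auto simp: paraderivable_def)
  then have last: "last ps \<in> set ps" and "consistent S (fst (last ps))"
    by (auto simp: paradeduction_iff_para_justified)
  have "fst (last ps) \<subseteq> A" "entails V (fst (last ps)) a"
    using label_sound[OF assms(1,4) ps(1) last] ps(2) by auto
  moreover have "satisfiable V (fst (last ps))"
    using consistent_iff_satisfiable[OF assms(3,4)] \<open>consistent S (fst (last ps))\<close>
      \<open>fst (last ps) \<subseteq> A\<close> A by blast
  ultimately show "paraentails V A a"
    by (auto simp: paraentails_def)
qed

end
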